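(* Assume: (a) $U(u,t)$ is nondecreasing in $u$ and in $t$, and $\lim_{t\to+\infty}U(u,t)=+\infty$ for every $u\ge 0$; (b) there exist constants $u_*\ge 0$, $c_*>0$, $L>0$ such that $U(u,t)\ge u+c_*t$ for all $u\ge u_*$, $t\ge 0$, and $$\int_0^{+\infty}e^{Lz}\,dF(z)\int_0^{+\infty}e^{-c_*Lt}\,dK(t)\le 1;$$ (c) $K(t)\,F(z)<1$ for all $t,z\ge 0$. Put $\varphi_*(u)=\max\{0,1-e^{-L(u-u_* )}\}$. Then: 1) the equation $\varphi=A\varphi$ has a nondecreasing solution $\varphi$ with $1\ge\varphi(u)\ge\varphi_*(u)$ for all $u\ge 0$; 2) $\varphi$ is the unique nondecreasing solution $[0,+\infty)\to[0,1]$ of $\varphi=A\varphi$ satisfying $\lim_{u\to+\infty}\varphi(u)=1$; 3) the sequence $\varphi^{k+1}=A\varphi^k$, $k=0,1,\dots$, started from $\varphi^0\equiv 1$ converges pointwise to $\varphi$ monotonically from above, and started from $\varphi^0=\varphi_*$ converges pointwise to $\varphi$ monotonically from below; 4) for any initial function $\varphi^0$ with $1\ge\varphi^0(u)\ge\varphi_*(u)$ for all $u\ge0$, the sequence $\varphi^{k+1}=A\varphi^k$ converges pointwise to $\varphi$.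
   Context: Let $F$ be the distribution function of a claim size ($F(z)=0$ for $z\le 0$) and $K$ the distribution function of the (nonnegative) time between successive claims. Let $c(\cdot)\ge 0$ be a piecewise continuous premium rate and let $U(u,t)$, $u,t\ge0$, be the solution of the Cauchy problem $dU/dt=c(U)$, $U(u,0)=u$ (the reserve at time $t$ in the absence of claims), assumed well defined for all $t\ge 0$. The operator $A$ acts on bounded Borel functions $\varphi:[0,+\infty)\to\mathbb R$ by $$A\varphi(u)=\int_0^{+\infty}\int_0^{U(u,t)}\varphi(U(u,t)-z)\,dF(z)\,dK(t),\qquad u\ge 0,$$ where integrals are Lebesgue–Stieltjes integrals and endpoints of the integration intervals are included. All initial functions are Borel measurable. *)

theory Defs
  imports "HOL-Probability.Probability"
begin

definition distribution_function :: "(real \<Rightarrow> real) \<Rightarrow> bool" where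
  "distribution_function F \<longleftrightarrow>
     mono F \<and> (\<forall>x. continuous (at_right x) F) \<and>
     (F \<longlongrightarrow> 0) at_bot \<and> (F \<longlongrightarrow> 1) at_top"

text \<open>On \<open>[0,\<infinity>)\<close>: finitely many discontinuities in each bounded interval, with finite
  one-sided limits everywhere.\<close>

definition piecewise_continuous :: "(real \<Rightarrow> real) \<Rightarrow> bool" where
  "piecewise_continuous c \<longleftrightarrow>
     (\<exists>D. (\<forall>b. finite (D \<inter> {0..b})) \<and> continuous_on ({0..} - D) c) \<and>
     (\<forall>x\<ge>0. \<exists>l. (c \<longlongrightarrow> l) (at_right x)) \<and>
     (\<forall>x>0. \<exists>l. (c \<longlongrightarrow> l) (at_left x))"

text \<open>Since \<open>c\<close> may jump, a solution of \<open>dy/dt = c(y)\<close>, \<open>y(0) = u\<close> may have kinks: it is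
  continuous, and the equation holds outside a set of times with finitely many elements in each
  bounded interval.\<close>

definition cauchy_solution :: "(real \<Rightarrow> real) \<Rightarrow> real \<Rightarrow> (real \<Rightarrow> real) \<Rightarrow> bool" where
  "cauchy_solution c u y \<longleftrightarrow>
     y 0 = u \<and> (\<forall>t\<ge>0. y t \<ge> 0) \<and> continuous_on {0..} y \<and>
     (\<exists>S. (\<forall>b. finite (S \<inter> {0..b})) \<and>
          (\<forall>t\<in>{0..} - S. (y has_real_derivative c (y t)) (at t within {0..})))"

definition reserve_flow :: "(real \<Rightarrow> real) \<Rightarrow> (real \<Rightarrow> real \<Rightarrow> real) \<Rightarrow> bool" where
  "reserve_flow c U \<longleftrightarrow>
     (\<forall>u\<ge>0. cauchy_solution c u (U u) \<and>
            (\<forall>y. cauchy_solution c u y \<longrightarrow> (\<forall>t\<ge>0. y t = U u t)))"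

text \<open>Functions on \<open>[0,\<infinity>)\<close> are represented by functions on the reals; for \<open>u \<ge> 0\<close> and
  \<open>U u t \<ge> 0\<close> the value at \<open>u\<close> depends only on the restriction of \<open>\<phi>\<close> to \<open>[0,\<infinity>)\<close>.\<close>

definition risk_op ::
  "(real \<Rightarrow> real) \<Rightarrow> (real \<Rightarrow> real) \<Rightarrow> (real \<Rightarrow> real \<Rightarrow> real) \<Rightarrow> (real \<Rightarrow> real) \<Rightarrow> real \<Rightarrow> real" where
  "risk_op F K U \<phi> u =
     (LINT t:{0..}|interval_measure K. (LINT z:{0..U u t}|interval_measure F. \<phi> (U u t - z)))"

definition phi_star :: "real \<Rightarrow> real \<Rightarrow> real \<Rightarrow> real" where
  "phi_star L u\<^sub>0 u = max 0 (1 - exp (- L * (u - u\<^sub>0)))"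

end

theory Submission
  imports Defs
begin

text \<open>
  With \<open>T\<close> and \<open>Z\<close> independent of laws \<open>K\<close> and \<open>F\<close>, the operator is
  \<open>A \<phi> u = E [\<phi> (U u T - Z); Z \<le> U u T]\<close>: one step of a Markov chain that is killed when the
  reserve becomes negative. The iterates of \<open>1\<close> are the probabilities of surviving \<open>k\<close> claims; they
  decrease to the survival probability \<open>\<phi>\<close>, the largest subsolution below \<open>1\<close>. The exponential
  moment condition makes \<open>\<phi>\<^sub>*\<close> a subsolution, so its iterates increase to a fixed point \<open>\<theta> \<le> \<phi>\<close>,
  and \<open>\<phi> - \<theta>\<close> vanishes at infinity. A maximum principle gives \<open>\<phi> \<le> \<theta>\<close>: if \<open>s > 0\<close> is the
  supremum of \<open>\<phi> - \<theta>\<close> and \<open>\<phi> - \<theta> \<le> s/2\<close> beyond \<open>b\<close>, it is enough that the chain leaves \<open>[0, b]\<close>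
  in a single step with probability bounded below. It does so by ruin when \<open>F < 1\<close> everywhere and
  by growth when \<open>K < 1\<close> everywhere, and \<open>K t * F z < 1\<close> forces one of the two.
\<close>

section \<open>Measures and distribution functions\<close>

lemma LIMSEQ_floor_mult_divide:
  fixes x :: real
  shows "(\<lambda>n. real_of_int \<lfloor>real (Suc n) * x\<rfloor> / real (Suc n)) \<longlonglongrightarrow> x"
proof (rule tendsto_sandwich)
  have "x - inverse (real (Suc n)) = (real (Suc n) * x - 1) / real (Suc n)" for n
    by (simp add: field_simps)
  then show "\<forall>\<^sub>F n in sequentially. x - inverse (real (Suc n)) \<le> \<lfloor>real (Suc n) * x\<rfloor> / real (Suc n)"
    by (intro always_eventually allI) (simp only:, intro divide_right_mono; linarith)
  show "\<forall>\<^sub>F n in sequentially. \<lfloor>real (Suc n) * x\<rfloor> / real (Suc n) \<le> x"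
    by (intro always_eventually allI)
      (simp add: divide_le_eq mult.commute of_int_floor_le del: of_nat_Suc)
  show "(\<lambda>n. x - inverse (real (Suc n))) \<longlonglongrightarrow> x"
    using tendsto_diff[OF tendsto_const LIMSEQ_inverse_real_of_nat, of x] by simp
qed simp

lemma borel_measurable_Caratheodory:
  fixes f :: "'a \<Rightarrow> real \<Rightarrow> 'b::metric_space"
  assumes meas: "\<And>t. (\<lambda>x. f x t) \<in> borel_measurable M"
    and cont: "\<And>x. x \<in> space M \<Longrightarrow> continuous_on UNIV (f x)"
  shows "case_prod f \<in> borel_measurable (M \<Otimes>\<^sub>M borel)"
proof (rule borel_measurable_LIMSEQ_metric)
  let ?g = "\<lambda>n p. f (fst p) (real_of_int \<lfloor>real (Suc n) * snd p\<rfloor> / real (Suc n))"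
  show "?g n \<in> borel_measurable (M \<Otimes>\<^sub>M borel)" for n
  proof (rule measurable_compose_countable[where f = "\<lambda>i p. f (fst p) (real_of_int i / real (Suc n))"])
    show "(\<lambda>p. f (fst p) (real_of_int i / real (Suc n))) \<in> borel_measurable (M \<Otimes>\<^sub>M borel)" for i
      by (rule measurable_compose[OF measurable_fst meas])
    show "(\<lambda>p::'a \<times> real. \<lfloor>real (Suc n) * snd p\<rfloor>) \<in> M \<Otimes>\<^sub>M borel \<rightarrow>\<^sub>M count_space UNIV"
      by measurable
  qed
  fix p assume "p \<in> space (M \<Otimes>\<^sub>M (borel :: real measure))"
  then have "isCont (f (fst p)) (snd p)"
    using cont[of "fst p"] by (auto simp: continuous_on_eq_continuous_at space_pair_measure)
  then show "(\<lambda>n. ?g n p) \<longlonglongrightarrow> case_prod f p"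
    unfolding case_prod_beta using LIMSEQ_floor_mult_divide by (rule isCont_tendsto_compose)
qed

lemma (in sigma_finite_measure) nn_integral_pair_mult:
  assumes [measurable]: "f \<in> borel_measurable N" "g \<in> borel_measurable M"
  shows "(\<integral>\<^sup>+p. f (fst p) * g (snd p) \<partial>(N \<Otimes>\<^sub>M M)) = (\<integral>\<^sup>+x. f x \<partial>N) * (\<integral>\<^sup>+y. g y \<partial>M)"
proof -
  have "(\<integral>\<^sup>+p. f (fst p) * g (snd p) \<partial>(N \<Otimes>\<^sub>M M)) = (\<integral>\<^sup>+x. \<integral>\<^sup>+y. f x * g y \<partial>M \<partial>N)"
    by (subst nn_integral_fst[symmetric]) simp_all
  also have "\<dots> = (\<integral>\<^sup>+x. f x * (\<integral>\<^sup>+y. g y \<partial>M) \<partial>N)"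
    by (simp add: nn_integral_cmult)
  also have "\<dots> = (\<integral>\<^sup>+x. f x \<partial>N) * (\<integral>\<^sup>+y. g y \<partial>M)"
    by (rule nn_integral_multc) measurable
  finally show ?thesis .
qed

lemma (in pair_prob_space) prob_Times:
  assumes "A \<in> sets M1" "B \<in> sets M2"
  shows "P.prob (A \<times> B) = M1.prob A * M2.prob B"
  using M2.emeasure_pair_measure_Times[OF assms]
  by (simp add: measure_def enn2real_mult)

lemma (in pair_prob_space) AE_pair_fst_snd:
  assumes "Measurable.pred M1 Q" "Measurable.pred M2 R" "AE x in M1. Q x" "AE y in M2. R y"
  shows "AE p in M1 \<Otimes>\<^sub>M M2. Q (fst p) \<and> R (snd p)"
proof (rule AE_pair_measure)
  note [measurable] = assms(1,2)
  show "{p \<in> space (M1 \<Otimes>\<^sub>M M2). Q (fst p) \<and> R (snd p)} \<in> sets (M1 \<Otimes>\<^sub>M M2)"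
    by measurable
  from assms(3) show "AE x in M1. AE y in M2. Q (fst (x, y)) \<and> R (snd (x, y))"
    by eventually_elim (use assms(4) in simp)
qed

lemma distribution_function_imp_real_distribution:
  assumes "distribution_function G"
  shows "real_distribution (interval_measure G)"
  using assms unfolding distribution_function_def
  by (intro real_distribution_interval_measure) (auto dest: monoD)

lemma cdf_distribution_function:
  assumes "distribution_function G"
  shows "cdf (interval_measure G) = G"
  using assms unfolding distribution_function_def
  by (intro cdf_interval_measure) (auto dest: monoD)

lemma distribution_function_le_1:
  assumes "distribution_function G"
  shows "G x \<le> 1"
  using real_distribution.cdf_bounded_prob[OF distribution_function_imp_real_distribution[OF assms]]
  by (simp add: cdf_distribution_function[OF assms])

lemma measure_distribution_function_Iic:
  assumes "distribution_function G"
  shows "measure (interval_measure G) {..x} = G x"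
  using fun_cong[OF cdf_distribution_function[OF assms], of x] by (simp add: cdf_def)

lemma measure_distribution_function_Ioi:
  assumes "distribution_function G"
  shows "measure (interval_measure G) {x<..} = 1 - G x"
proof -
  interpret real_distribution "interval_measure G"
    using assms by (rule distribution_function_imp_real_distribution)
  have "{x<..} = space (interval_measure G) - {..x}" by auto
  then show ?thesis
    using prob_compl[of "{..x}"] measure_distribution_function_Iic[OF assms] by simp
qed

lemma AE_distribution_function_ge:
  assumes G: "distribution_function G" and zero: "\<And>x. x < a \<Longrightarrow> G x = 0"
  shows "AE x in interval_measure G. a \<le> x"
proof -
  interpret real_distribution "interval_measure G"
    using G by (rule distribution_function_imp_real_distribution)
  have "(G \<longlongrightarrow> prob {..<a}) (at_left a)"
    using cdf_at_left[of a] by (simp add: cdf_distribution_function[OF G])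
  moreover have "(G \<longlongrightarrow> 0) (at_left a)"
    using zero by (intro tendsto_eventually) (auto simp: eventually_at_filter)
  ultimately have "prob {..<a} = 0"
    by (rule tendsto_unique[rotated]) simp
  then show ?thesis
    by (intro AE_I[of _ _ "{..<a}"]) (auto simp: emeasure_eq_measure)
qed

lemma eventually_at_top_obtains_ge:
  fixes a :: "'a::linorder"
  assumes "eventually Q at_top"
  obtains x where "a \<le> x" "Q x"
  using assms unfolding eventually_at_top_linorder by (meson max.cobounded1 max.cobounded2)

lemma distribution_function_pos:
  assumes "distribution_function G"
  obtains x where "a \<le> x" "0 < G x"
proof -
  have "\<forall>\<^sub>F x in at_top. 0 < G x"
    using assms by (auto simp: distribution_function_def intro: order_tendstoD)
  then show ?thesis
    using that by (rule eventually_at_top_obtains_ge)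
qed

section \<open>Transition operators of killed random maps\<close>

locale killed_random_map = prob_space M
  for M :: "'w measure" +
  fixes B :: "'x measure" and S :: "'x set" and X :: "'x \<Rightarrow> 'w \<Rightarrow> 'x"
  assumes sets_S [measurable]: "S \<in> sets B"
    and measurable_X: "case_prod X \<in> restrict_space B S \<Otimes>\<^sub>M M \<rightarrow>\<^sub>M B"
begin

definition killed :: "('x \<Rightarrow> real) \<Rightarrow> 'x \<Rightarrow> real" where
  "killed \<phi> x = (if x \<in> S then \<phi> x else 0)"

definition transition_op :: "('x \<Rightarrow> real) \<Rightarrow> 'x \<Rightarrow> real" where
  "transition_op \<phi> u = expectation (\<lambda>\<omega>. killed \<phi> (X u \<omega>))"

definition bounded_measurable :: "real \<Rightarrow> ('x \<Rightarrow> real) set" where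
  "bounded_measurable C = {\<phi> \<in> borel_measurable (restrict_space B S). \<forall>u\<in>S. \<bar>\<phi> u\<bar> \<le> C}"

lemma measurable_of_bounded_measurable:
  "\<phi> \<in> bounded_measurable C \<Longrightarrow> \<phi> \<in> borel_measurable (restrict_space B S)"
  by (simp add: bounded_measurable_def)

lemma bounded_measurable_1I:
  assumes "\<phi> \<in> borel_measurable (restrict_space B S)"
    and "\<And>u. u \<in> S \<Longrightarrow> 0 \<le> \<phi> u" "\<And>u. u \<in> S \<Longrightarrow> \<phi> u \<le> 1"
  shows "\<phi> \<in> bounded_measurable 1"
  using assms by (simp add: bounded_measurable_def)

lemma bounded_measurable_abs_le: "\<phi> \<in> bounded_measurable C \<Longrightarrow> u \<in> S \<Longrightarrow> \<bar>\<phi> u\<bar> \<le> C"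
  by (simp add: bounded_measurable_def)

lemma space_restrict_S: "space (restrict_space B S) = S"
  using sets.sets_into_space[OF sets_S] by (auto simp: space_restrict_space)

lemma measurable_killed:
  assumes "\<phi> \<in> borel_measurable (restrict_space B S)"
  shows "killed \<phi> \<in> borel_measurable B"
proof -
  have "killed \<phi> = (\<lambda>x. indicator S x *\<^sub>R \<phi> x)"
    by (auto simp: killed_def)
  then show ?thesis
    using assms by (simp add: borel_measurable_restrict_space_iff)
qed

lemma measurable_X_right: "u \<in> S \<Longrightarrow> X u \<in> M \<rightarrow>\<^sub>M B"
  using measurable_compose[OF measurable_Pair1' measurable_X, of u] by (simp add: space_restrict_S)

lemma measurable_killed_X:
  assumes "\<phi> \<in> bounded_measurable C" "u \<in> S"
  shows "(\<lambda>\<omega>. killed \<phi> (X u \<omega>)) \<in> borel_measurable M"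
  using measurable_X_right[OF assms(2)]
    measurable_killed[OF measurable_of_bounded_measurable[OF assms(1)]]
  by (rule measurable_compose)

lemma abs_killed_X_le:
  assumes "\<phi> \<in> bounded_measurable C" "u \<in> S"
  shows "\<bar>killed \<phi> (X u \<omega>)\<bar> \<le> C"
  using bounded_measurable_abs_le[OF assms(1)] assms(2) abs_ge_zero[of "\<phi> u"]
  by (fastforce simp: killed_def intro: order_trans)

lemma integrable_killed_X:
  assumes "\<phi> \<in> bounded_measurable C" "u \<in> S"
  shows "integrable M (\<lambda>\<omega>. killed \<phi> (X u \<omega>))"
  using assms by (intro integrable_const_bound[where B = C] measurable_killed_X AE_I2)
    (simp_all add: abs_killed_X_le)

lemma killed_mono: "(\<And>x. x \<in> S \<Longrightarrow> \<phi> x \<le> \<psi> x) \<Longrightarrow> killed \<phi> x \<le> killed \<psi> x"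
  by (simp add: killed_def)

lemma transition_op_mono:
  assumes "\<phi> \<in> bounded_measurable C" "\<psi> \<in> bounded_measurable D" "\<And>x. x \<in> S \<Longrightarrow> \<phi> x \<le> \<psi> x" "u \<in> S"
  shows "transition_op \<phi> u \<le> transition_op \<psi> u"
  unfolding transition_op_def using assms by (intro integral_mono integrable_killed_X killed_mono)

lemma transition_op_nonneg:
  assumes "\<And>x. x \<in> S \<Longrightarrow> 0 \<le> \<phi> x"
  shows "0 \<le> transition_op \<phi> u"
  unfolding transition_op_def using assms
  by (intro Bochner_Integration.integral_nonneg) (simp add: killed_def)

lemma transition_op_diff:
  assumes "\<phi> \<in> bounded_measurable C" "\<psi> \<in> bounded_measurable D" "u \<in> S"
  shows "transition_op (\<lambda>x. \<phi> x - \<psi> x) u = transition_op \<phi> u - transition_op \<psi> u"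
proof -
  have "killed (\<lambda>x. \<phi> x - \<psi> x) y = killed \<phi> y - killed \<psi> y" for y
    by (simp add: killed_def)
  then show ?thesis
    unfolding transition_op_def using assms
    by (simp add: integrable_killed_X)
qed

lemma bounded_measurable_diff:
  assumes "\<phi> \<in> bounded_measurable C" "\<psi> \<in> bounded_measurable D"
  shows "(\<lambda>x. \<phi> x - \<psi> x) \<in> bounded_measurable (C + D)"
  using assms unfolding bounded_measurable_def
  by (auto intro!: order_trans[OF abs_triangle_ineq4] add_mono)

lemma transition_op_bounded_measurable:
  assumes \<phi>: "\<phi> \<in> bounded_measurable C"
  shows "transition_op \<phi> \<in> bounded_measurable C"
  unfolding bounded_measurable_def
proof (intro CollectI conjI ballI)
  have "(\<lambda>(u, \<omega>). killed \<phi> (X u \<omega>)) \<in> borel_measurable (restrict_space B S \<Otimes>\<^sub>M M)"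
    using measurable_killed[OF measurable_of_bounded_measurable[OF \<phi>]]
      measurable_compose[OF measurable_X]
    by (simp add: case_prod_beta')
  then show "transition_op \<phi> \<in> borel_measurable (restrict_space B S)"
    unfolding transition_op_def[abs_def] by (rule borel_measurable_lebesgue_integral)
next
  fix u assume u: "u \<in> S"
  have "\<bar>transition_op \<phi> u\<bar> \<le> expectation (\<lambda>\<omega>. \<bar>killed \<phi> (X u \<omega>)\<bar>)"
    unfolding transition_op_def by (rule integral_abs_bound)
  also have "\<dots> \<le> C"
    using \<phi> u by (intro integral_le_const integrable_abs integrable_killed_X)
      (simp_all add: abs_killed_X_le)
  finally show "\<bar>transition_op \<phi> u\<bar> \<le> C" .
qed

lemma funpow_transition_op_bounded_measurable:
  "\<phi> \<in> bounded_measurable C \<Longrightarrow> (transition_op ^^ k) \<phi> \<in> bounded_measurable C"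
  by (induction k) (simp_all add: transition_op_bounded_measurable)

lemma funpow_transition_op_nonneg:
  "(\<And>x. x \<in> S \<Longrightarrow> 0 \<le> \<phi> x) \<Longrightarrow> u \<in> S \<Longrightarrow> 0 \<le> (transition_op ^^ k) \<phi> u"
  by (induction k arbitrary: u) (simp_all add: transition_op_nonneg)

lemma funpow_transition_op_mono:
  assumes "\<phi> \<in> bounded_measurable C" "\<psi> \<in> bounded_measurable D" "\<And>x. x \<in> S \<Longrightarrow> \<phi> x \<le> \<psi> x" "u \<in> S"
  shows "(transition_op ^^ k) \<phi> u \<le> (transition_op ^^ k) \<psi> u"
  using assms(4)
proof (induction k arbitrary: u)
  case (Suc k)
  then show ?case
    using assms(1,2) by (auto intro: transition_op_mono funpow_transition_op_bounded_measurable)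
qed (simp add: assms(3))

lemma incseq_funpow_transition_op:
  assumes f: "f \<in> bounded_measurable C" and sub: "\<And>x. x \<in> S \<Longrightarrow> f x \<le> transition_op f x"
    and u: "u \<in> S"
  shows "incseq (\<lambda>k. (transition_op ^^ k) f u)"
proof (rule incseq_SucI)
  show "(transition_op ^^ k) f u \<le> (transition_op ^^ Suc k) f u" for k
    using funpow_transition_op_mono[OF f transition_op_bounded_measurable[OF f] sub u, of k]
    by (simp add: funpow_swap1)
qed

lemma decseq_funpow_transition_op:
  assumes f: "f \<in> bounded_measurable C" and super: "\<And>x. x \<in> S \<Longrightarrow> transition_op f x \<le> f x"
    and u: "u \<in> S"
  shows "decseq (\<lambda>k. (transition_op ^^ k) f u)"
proof (rule decseq_SucI)
  show "(transition_op ^^ Suc k) f u \<le> (transition_op ^^ k) f u" for k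
    using funpow_transition_op_mono[OF transition_op_bounded_measurable[OF f] f super u, of k]
    by (simp add: funpow_swap1)
qed

subsection \<open>Limits of iterates\<close>

lemma bounded_measurable_limit:
  assumes f: "\<And>k::nat. f k \<in> bounded_measurable C" and lim: "\<And>x. x \<in> S \<Longrightarrow> (\<lambda>k. f k x) \<longlonglongrightarrow> \<phi> x"
  shows "\<phi> \<in> bounded_measurable C"
  unfolding bounded_measurable_def
proof (intro CollectI conjI ballI)
  show "\<phi> \<in> borel_measurable (restrict_space B S)"
    by (rule borel_measurable_LIMSEQ_real[OF lim measurable_of_bounded_measurable[OF f]])
      (simp add: space_restrict_S)
  show "\<bar>\<phi> u\<bar> \<le> C" if "u \<in> S" for u
    using tendsto_rabs[OF lim[OF that]] bounded_measurable_abs_le[OF f that]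
    by (intro LIMSEQ_le_const2) auto
qed

lemma transition_op_tendsto:
  assumes f: "\<And>k::nat. f k \<in> bounded_measurable C" and lim: "\<And>x. x \<in> S \<Longrightarrow> (\<lambda>k. f k x) \<longlonglongrightarrow> \<phi> x"
    and u: "u \<in> S"
  shows "(\<lambda>k. transition_op (f k) u) \<longlonglongrightarrow> transition_op \<phi> u"
  unfolding transition_op_def
proof (rule integral_dominated_convergence[where w = "\<lambda>_. C"])
  show "(\<lambda>\<omega>. killed \<phi> (X u \<omega>)) \<in> borel_measurable M"
    using bounded_measurable_limit[OF f lim] u by (rule measurable_killed_X)
  show "(\<lambda>\<omega>. killed (f k) (X u \<omega>)) \<in> borel_measurable M" for k
    using f u by (rule measurable_killed_X)
  show "AE \<omega> in M. (\<lambda>k. killed (f k) (X u \<omega>)) \<longlonglongrightarrow> killed \<phi> (X u \<omega>)"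
    using lim by (simp add: killed_def)
  show "AE \<omega> in M. norm (killed (f k) (X u \<omega>)) \<le> C" for k
    using f u by (simp add: abs_killed_X_le)
qed simp

definition iterates_limit :: "('x \<Rightarrow> real) \<Rightarrow> 'x \<Rightarrow> real" where
  "iterates_limit f u = lim (\<lambda>k. (transition_op ^^ k) f u)"

context
  fixes f :: "'x \<Rightarrow> real" and C :: real
  assumes f: "f \<in> bounded_measurable C"
    and monoseq: "\<And>u. u \<in> S \<Longrightarrow> monoseq (\<lambda>k. (transition_op ^^ k) f u)"
begin

lemma funpow_transition_op_tendsto:
  assumes "u \<in> S"
  shows "(\<lambda>k. (transition_op ^^ k) f u) \<longlonglongrightarrow> iterates_limit f u"
proof -
  have "Bseq (\<lambda>k. (transition_op ^^ k) f u)"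
    using bounded_measurable_abs_le[OF funpow_transition_op_bounded_measurable[OF f] assms]
    by (intro BseqI'[of _ C]) simp
  then show ?thesis
    unfolding iterates_limit_def
    using Bseq_monoseq_convergent[OF _ monoseq[OF assms]] convergent_LIMSEQ_iff by blast
qed

lemma iterates_limit_bounded_measurable: "iterates_limit f \<in> bounded_measurable C"
  using funpow_transition_op_bounded_measurable[OF f] funpow_transition_op_tendsto
  by (rule bounded_measurable_limit)

lemma transition_op_iterates_limit:
  assumes "u \<in> S"
  shows "transition_op (iterates_limit f) u = iterates_limit f u"
proof (rule LIMSEQ_unique)
  show "(\<lambda>k. transition_op ((transition_op ^^ k) f) u) \<longlonglongrightarrow> transition_op (iterates_limit f) u"
    using funpow_transition_op_bounded_measurable[OF f] funpow_transition_op_tendsto assms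
    by (rule transition_op_tendsto)
  show "(\<lambda>k. transition_op ((transition_op ^^ k) f) u) \<longlonglongrightarrow> iterates_limit f u"
    using LIMSEQ_Suc[OF funpow_transition_op_tendsto[OF assms]] by simp
qed

end

subsection \<open>The comparison principle\<close>

definition exits_uniformly :: "'x set \<Rightarrow> bool" where
  "exits_uniformly D \<longleftrightarrow> (\<exists>q>0. \<forall>u\<in>S \<inter> D. q \<le> prob {\<omega> \<in> space M. X u \<omega> \<notin> D})"

definition small_off_exit_sets :: "('x \<Rightarrow> real) \<Rightarrow> bool" where
  "small_off_exit_sets \<delta> \<longleftrightarrow> (\<forall>\<epsilon>>0. \<exists>D. exits_uniformly D \<and> (\<forall>x\<in>S - D. \<delta> x \<le> \<epsilon>))"

lemma transition_op_le_of_exit: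
  assumes \<delta>: "\<delta> \<in> bounded_measurable C" and u: "u \<in> S"
    and le: "\<And>x. x \<in> S \<Longrightarrow> \<delta> x \<le> s" "\<And>x. x \<in> S - D \<Longrightarrow> \<delta> x \<le> r" and "0 \<le> r" "r \<le> s"
    and E: "{\<omega> \<in> space M. X u \<omega> \<notin> D} \<in> events"
  shows "transition_op \<delta> u \<le> s - (s - r) * prob {\<omega> \<in> space M. X u \<omega> \<notin> D}"
proof -
  let ?E = "{\<omega> \<in> space M. X u \<omega> \<notin> D}"
  have "transition_op \<delta> u \<le> expectation (\<lambda>\<omega>. s - (s - r) * indicator ?E \<omega>)"
    unfolding transition_op_def
  proof (intro integral_mono integrable_killed_X[OF \<delta> u])
    show "integrable M (\<lambda>\<omega>. s - (s - r) * indicator ?E \<omega>)"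
      using E by (auto intro!: integrable_real_indicator simp: emeasure_eq_measure)
    show "killed \<delta> (X u \<omega>) \<le> s - (s - r) * indicator ?E \<omega>" if "\<omega> \<in> space M" for \<omega>
      using le[of "X u \<omega>"] \<open>0 \<le> r\<close> \<open>r \<le> s\<close> that by (auto simp: killed_def indicator_def)
  qed
  also have "\<dots> = s - (s - r) * prob ?E"
    using E by (subst Bochner_Integration.integral_diff)
      (auto intro!: integrable_real_indicator simp: emeasure_eq_measure prob_space)
  finally show ?thesis .
qed

lemma maximum_principle:
  assumes \<delta>: "\<delta> \<in> bounded_measurable C" and sub: "\<And>x. x \<in> S \<Longrightarrow> \<delta> x \<le> transition_op \<delta> x"
    and small: "small_off_exit_sets \<delta>" and x: "x \<in> S"
  shows "\<delta> x \<le> 0"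
proof (rule ccontr)
  assume pos: "\<not> \<delta> x \<le> 0"
  define s where "s = (SUP y\<in>S. \<delta> y)"
  have "bdd_above (\<delta> ` S)"
    using bounded_measurable_abs_le[OF \<delta>] by (intro bdd_aboveI[where M = C]) force
  then have le: "\<delta> y \<le> s" if "y \<in> S" for y
    unfolding s_def using that by (rule cSUP_upper[rotated])
  have s: "0 < s" using le[OF x] pos by linarith
  obtain D q where D: "\<And>y. y \<in> S - D \<Longrightarrow> \<delta> y \<le> s / 2" and q: "0 < q"
    and exit: "\<And>u. u \<in> S \<inter> D \<Longrightarrow> q \<le> prob {\<omega> \<in> space M. X u \<omega> \<notin> D}"
    using small s unfolding small_off_exit_sets_def exits_uniformly_def
    by (metis half_gt_zero)
  have "\<delta> u \<le> max (s / 2) (s - s / 2 * q)" if u: "u \<in> S" for u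
  proof (cases "u \<in> D")
    case True
    let ?E = "{\<omega> \<in> space M. X u \<omega> \<notin> D}"
    have "?E \<in> events"
      using exit[of u] q True u by (metis IntI measure_notin_sets not_le)
    then have "\<delta> u \<le> s - s / 2 * prob ?E"
      using sub[OF u] transition_op_le_of_exit[OF \<delta> u le D] s by force
    also have "\<dots> \<le> s - s / 2 * q"
      using exit[of u] True u s by (simp add: mult_left_mono)
    finally show ?thesis by simp
  next
    case False
    then show ?thesis using D[of u] u by simp
  qed
  then have "(SUP y\<in>S. \<delta> y) \<le> max (s / 2) (s - s / 2 * q)"
    using x by (intro cSUP_least) auto
  then have "s \<le> max (s / 2) (s - s / 2 * q)" by (fold s_def)
  moreover have "0 < s / 2 * q" using s q by simp
  ultimately show False using s by linarith
qed

lemma comparison_principle: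
  assumes "\<phi> \<in> bounded_measurable C" "\<psi> \<in> bounded_measurable D"
    and "\<And>x. x \<in> S \<Longrightarrow> \<phi> x \<le> transition_op \<phi> x" "\<And>x. x \<in> S \<Longrightarrow> transition_op \<psi> x \<le> \<psi> x"
    and "small_off_exit_sets (\<lambda>x. \<phi> x - \<psi> x)" and "u \<in> S"
  shows "\<phi> u \<le> \<psi> u"
proof -
  have "\<phi> x - \<psi> x \<le> transition_op (\<lambda>x. \<phi> x - \<psi> x) x" if "x \<in> S" for x
    using assms(3,4)[OF that] by (simp add: transition_op_diff[OF assms(1,2) that])
  then show ?thesis
    using maximum_principle[OF bounded_measurable_diff[OF assms(1,2)] _ assms(5,6)] by simp
qed

lemma small_off_exit_sets_mono:
  assumes "small_off_exit_sets \<delta>" "\<And>x. x \<in> S \<Longrightarrow> \<gamma> x \<le> \<delta> x"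
  shows "small_off_exit_sets \<gamma>"
  using assms unfolding small_off_exit_sets_def by (meson DiffD1 order_trans)

subsection \<open>The survival probability\<close>

definition survival_prob :: "'x \<Rightarrow> real" where
  "survival_prob = iterates_limit (\<lambda>_. 1)"

lemma one_bounded_measurable: "(\<lambda>_. 1) \<in> bounded_measurable 1"
  by (simp add: bounded_measurable_def)

lemma decseq_funpow_transition_op_one:
  assumes "u \<in> S"
  shows "decseq (\<lambda>k. (transition_op ^^ k) (\<lambda>_. 1) u)"
  using one_bounded_measurable _ assms
proof (rule decseq_funpow_transition_op)
  show "transition_op (\<lambda>_. 1) x \<le> 1" if "x \<in> S" for x
    using bounded_measurable_abs_le[OF transition_op_bounded_measurable[OF one_bounded_measurable] that]
    by simp
qed

lemma
  shows survival_prob_bounded_measurable: "survival_prob \<in> bounded_measurable 1"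
    and transition_op_survival_prob: "u \<in> S \<Longrightarrow> transition_op survival_prob u = survival_prob u"
    and funpow_transition_op_one_tendsto_survival_prob:
      "u \<in> S \<Longrightarrow> (\<lambda>k. (transition_op ^^ k) (\<lambda>_. 1) u) \<longlonglongrightarrow> survival_prob u"
  unfolding survival_prob_def
  using one_bounded_measurable decseq_funpow_transition_op_one[THEN decseq_imp_monoseq]
  by (blast intro: iterates_limit_bounded_measurable transition_op_iterates_limit
      funpow_transition_op_tendsto)+

lemma survival_prob_le_1: "u \<in> S \<Longrightarrow> survival_prob u \<le> 1"
  using bounded_measurable_abs_le[OF survival_prob_bounded_measurable, of u] by simp

lemma subsolution_le_survival_prob:
  assumes f: "f \<in> bounded_measurable 1" and sub: "\<And>x. x \<in> S \<Longrightarrow> f x \<le> transition_op f x"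
    and u: "u \<in> S"
  shows "f u \<le> survival_prob u"
proof (rule LIMSEQ_le_const[OF funpow_transition_op_one_tendsto_survival_prob[OF u]],
    intro exI allI impI)
  fix k
  have "f u \<le> (transition_op ^^ k) f u"
    using incseqD[OF incseq_funpow_transition_op[OF f sub u], of 0 k] by simp
  also have "\<dots> \<le> (transition_op ^^ k) (\<lambda>_. 1) u"
    using f one_bounded_measurable _ u
    by (rule funpow_transition_op_mono) (use bounded_measurable_abs_le[OF f] in force)
  finally show "f u \<le> (transition_op ^^ k) (\<lambda>_. 1) u" .
qed

lemma transition_op_fixed_point_eq_survival_prob:
  assumes \<psi>: "\<psi> \<in> bounded_measurable 1" and fixed: "\<And>x. x \<in> S \<Longrightarrow> transition_op \<psi> x = \<psi> x"
    and small: "small_off_exit_sets (\<lambda>x. 1 - \<psi> x)" and u: "u \<in> S"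
  shows "\<psi> u = survival_prob u"
proof (rule antisym)
  show "\<psi> u \<le> survival_prob u"
    using \<psi> _ u by (rule subsolution_le_survival_prob) (simp add: fixed)
  have "small_off_exit_sets (\<lambda>x. survival_prob x - \<psi> x)"
    using small by (rule small_off_exit_sets_mono)
      (simp add: survival_prob_le_1)
  then show "survival_prob u \<le> \<psi> u"
    by (intro comparison_principle[OF survival_prob_bounded_measurable \<psi> _ _ _ u])
      (simp_all add: fixed transition_op_survival_prob)
qed

lemma funpow_transition_op_tendsto_survival_prob:
  assumes s: "s \<in> bounded_measurable 1" and sub: "\<And>x. x \<in> S \<Longrightarrow> s x \<le> transition_op s x"
    and small: "small_off_exit_sets (\<lambda>x. 1 - s x)"
    and f: "f \<in> bounded_measurable 1" and le: "\<And>x. x \<in> S \<Longrightarrow> s x \<le> f x" and u: "u \<in> S"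
  shows "(\<lambda>k. (transition_op ^^ k) f u) \<longlonglongrightarrow> survival_prob u"
proof -
  have monoseq: "monoseq (\<lambda>k. (transition_op ^^ k) s x)" if "x \<in> S" for x
    using incseq_funpow_transition_op[OF s sub that] by (rule incseq_imp_monoseq)
  have s_le: "s x \<le> iterates_limit s x" if "x \<in> S" for x
    using incseq_le[OF incseq_funpow_transition_op[OF s sub that]
        funpow_transition_op_tendsto[OF s monoseq that], of 0] by simp
  have "small_off_exit_sets (\<lambda>x. 1 - iterates_limit s x)"
    using small by (rule small_off_exit_sets_mono) (simp add: s_le)
  then have "iterates_limit s u = survival_prob u"
    using iterates_limit_bounded_measurable[OF s monoseq] transition_op_iterates_limit[OF s monoseq] u
    by (intro transition_op_fixed_point_eq_survival_prob)
  then have lower: "(\<lambda>k. (transition_op ^^ k) s u) \<longlonglongrightarrow> survival_prob u"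
    using funpow_transition_op_tendsto[OF s monoseq u] by simp
  show ?thesis
  proof (rule tendsto_sandwich[OF _ _ lower funpow_transition_op_one_tendsto_survival_prob[OF u]])
    show "\<forall>\<^sub>F k in sequentially. (transition_op ^^ k) s u \<le> (transition_op ^^ k) f u"
      by (intro always_eventually allI funpow_transition_op_mono[OF s f le u])
    show "\<forall>\<^sub>F k in sequentially. (transition_op ^^ k) f u \<le> (transition_op ^^ k) (\<lambda>_. 1) u"
      using bounded_measurable_abs_le[OF f]
      by (intro always_eventually allI funpow_transition_op_mono[OF f one_bounded_measurable _ u])
        force
  qed
qed

end

section \<open>The risk process\<close>

locale risk_model =
  fixes F K :: "real \<Rightarrow> real" and U :: "real \<Rightarrow> real \<Rightarrow> real"
  assumes F_dist: "distribution_function F" and F_neg: "\<And>z. z < 0 \<Longrightarrow> F z = 0"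
    and K_dist: "distribution_function K" and K_neg: "\<And>t. t < 0 \<Longrightarrow> K t = 0"
    and U_cont: "\<And>u. 0 \<le> u \<Longrightarrow> continuous_on {0..} (U u)"
    and U_mono: "\<And>t. 0 \<le> t \<Longrightarrow> mono_on {0..} (\<lambda>u. U u t)"
begin

sublocale K: real_distribution "interval_measure K"
  using K_dist by (rule distribution_function_imp_real_distribution)

sublocale F: real_distribution "interval_measure F"
  using F_dist by (rule distribution_function_imp_real_distribution)

sublocale pair_prob_space "interval_measure K" "interval_measure F"
  by unfold_locales

abbreviation claim_law :: "(real \<times> real) measure" where
  "claim_law \<equiv> interval_measure K \<Otimes>\<^sub>M interval_measure F"

text \<open>The flow is unconstrained at negative times, which have probability \<open>0\<close>; truncating them
  makes the map measurable.\<close>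

definition reserve_after_claim :: "real \<Rightarrow> real \<times> real \<Rightarrow> real" where
  "reserve_after_claim u p = U u (max 0 (fst p)) - snd p"

lemma measurable_reserve_after_claim:
  "case_prod reserve_after_claim \<in> borel_measurable (restrict_space borel {0..} \<Otimes>\<^sub>M claim_law)"
proof -
  have "case_prod (\<lambda>u t. U u (max 0 t)) \<in> borel_measurable (restrict_space borel {0..} \<Otimes>\<^sub>M borel)"
  proof (rule borel_measurable_Caratheodory)
    show "(\<lambda>u. U u (max 0 t)) \<in> borel_measurable (restrict_space borel {0..})" for t
      by (intro borel_measurable_mono_on_fnc U_mono) simp
    show "continuous_on UNIV (\<lambda>t. U u (max 0 t))" if "u \<in> space (restrict_space borel {0..})" for u
      using that by (intro continuous_on_compose2[OF U_cont] continuous_intros)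
        (auto simp: space_restrict_space)
  qed
  then have [measurable]:
    "(\<lambda>q. U (fst q) (max 0 (fst (snd q)))) \<in> borel_measurable (restrict_space borel {0..} \<Otimes>\<^sub>M claim_law)"
    using measurable_compose[of "\<lambda>q. (fst q, fst (snd q))" "restrict_space borel {0..} \<Otimes>\<^sub>M claim_law"]
    by simp
  show ?thesis
    unfolding reserve_after_claim_def case_prod_beta by measurable
qed

sublocale killed_random_map claim_law borel "{0..}" reserve_after_claim
  using measurable_reserve_after_claim by unfold_locales auto

lemma AE_claim_law_nonneg: "AE p in claim_law. 0 \<le> fst p \<and> 0 \<le> snd p"
  using AE_distribution_function_ge[OF K_dist K_neg] AE_distribution_function_ge[OF F_dist F_neg]
  by (intro AE_pair_fst_snd) simp_all

lemma risk_op_eq_transition_op: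
  assumes \<phi>: "\<phi> \<in> bounded_measurable C" and u: "0 \<le> u"
  shows "risk_op F K U \<phi> u = transition_op \<phi> u"
proof -
  let ?g = "\<lambda>p. indicator ({0..} \<times> {0..}) p * killed \<phi> (reserve_after_claim u p)"
  have int: "integrable claim_law (\<lambda>p. killed \<phi> (reserve_after_claim u p))"
    using integrable_killed_X[OF \<phi>] u by simp
  have "risk_op F K U \<phi> u = (\<integral>t. \<integral>z. ?g (t, z) \<partial>interval_measure F \<partial>interval_measure K)"
    unfolding risk_op_def set_lebesgue_integral_def
  proof (intro Bochner_Integration.integral_cong refl)
    fix t
    have "indicator {0..} t * (indicator {0..U u t} z * \<phi> (U u t - z)) = ?g (t, z)" for z
      by (auto simp: killed_def reserve_after_claim_def indicator_def max_def)
    then show "indicator {0..} t *\<^sub>R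
        (\<integral>z. indicator {0..U u t} z *\<^sub>R \<phi> (U u t - z) \<partial>interval_measure F)
        = (\<integral>z. ?g (t, z) \<partial>interval_measure F)"
      by (simp flip: integral_mult_right_zero)
  qed
  also have "\<dots> = (\<integral>p. ?g p \<partial>claim_law)"
    using integrable_real_mult_indicator[OF _ int] by (intro integral_fst') (simp add: mult.commute)
  also have "\<dots> = transition_op \<phi> u"
    unfolding transition_op_def
  proof (rule integral_cong_AE)
    show "AE p in claim_law. ?g p = killed \<phi> (reserve_after_claim u p)"
      using AE_claim_law_nonneg by eventually_elim (simp add: indicator_def mem_Times_iff)
  qed (use int in auto)
  finally show ?thesis .
qed

lemma risk_op_cong:
  assumes "\<And>x. 0 \<le> x \<Longrightarrow> \<phi> x = \<psi> x"
  shows "risk_op F K U \<phi> u = risk_op F K U \<psi> u"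
proof -
  have "indicator {0..y} z *\<^sub>R \<phi> (y - z) = indicator {0..y} z *\<^sub>R \<psi> (y - z)" for y z :: real
    using assms by (simp add: indicator_def)
  then show ?thesis
    unfolding risk_op_def set_lebesgue_integral_def by (simp only:)
qed

lemma funpow_risk_op_eq_transition_op:
  assumes "\<phi> \<in> bounded_measurable C" "0 \<le> u"
  shows "(risk_op F K U ^^ k) \<phi> u = (transition_op ^^ k) \<phi> u"
  using assms(2)
proof (induction k arbitrary: u)
  case (Suc k)
  have "(risk_op F K U ^^ Suc k) \<phi> u = risk_op F K U ((transition_op ^^ k) \<phi>) u"
    using risk_op_cong[OF Suc.IH] by simp
  also have "\<dots> = (transition_op ^^ Suc k) \<phi> u"
    using risk_op_eq_transition_op[OF funpow_transition_op_bounded_measurable[OF assms(1)] Suc.prems]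
    by simp
  finally show ?case .
qed simp

lemma survival_prob_eq_risk_op: "0 \<le> u \<Longrightarrow> survival_prob u = risk_op F K U survival_prob u"
  by (simp add: risk_op_eq_transition_op[OF survival_prob_bounded_measurable]
      transition_op_survival_prob)

lemma decseq_funpow_risk_op_one: "0 \<le> u \<Longrightarrow> decseq (\<lambda>k. (risk_op F K U ^^ k) (\<lambda>_. 1) u)"
  using decseq_funpow_transition_op_one[of u]
  by (simp add: funpow_risk_op_eq_transition_op[OF one_bounded_measurable])

lemma incseq_funpow_risk_op:
  assumes "f \<in> bounded_measurable C" "\<And>x. 0 \<le> x \<Longrightarrow> f x \<le> transition_op f x" "0 \<le> u"
  shows "incseq (\<lambda>k. (risk_op F K U ^^ k) f u)"
  using incseq_funpow_transition_op[of f C u] assms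
  by (simp add: funpow_risk_op_eq_transition_op[OF assms(1)])

subsection \<open>Monotonicity of the survival probability\<close>

lemma mono_killed:
  assumes "mono_on {0..} \<phi>" "\<And>x. 0 \<le> x \<Longrightarrow> 0 \<le> \<phi> x"
  shows "mono (killed \<phi>)"
  using assms by (auto intro!: monoI simp: killed_def mono_on_def)

lemma mono_on_transition_op:
  assumes "\<phi> \<in> bounded_measurable C" "mono_on {0..} \<phi>" "\<And>x. 0 \<le> x \<Longrightarrow> 0 \<le> \<phi> x"
  shows "mono_on {0..} (transition_op \<phi>)"
proof (rule mono_onI)
  fix u v :: real assume uv: "u \<in> {0..}" "v \<in> {0..}" "u \<le> v"
  have "reserve_after_claim u p \<le> reserve_after_claim v p" for p
    using mono_onD[OF U_mono uv] by (simp add: reserve_after_claim_def)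
  then show "transition_op \<phi> u \<le> transition_op \<phi> v"
    unfolding transition_op_def using uv(1,2)
    by (intro integral_mono integrable_killed_X[OF assms(1)] monoD[OF mono_killed[OF assms(2,3)]])
qed

lemma mono_on_survival_prob: "mono_on {0..} survival_prob"
proof (rule mono_onI)
  have mono: "mono_on {0..} ((transition_op ^^ k) (\<lambda>_. 1))" for k
  proof (induction k)
    case (Suc k)
    then show ?case
      using funpow_transition_op_bounded_measurable[OF one_bounded_measurable, of k]
        funpow_transition_op_nonneg[of "\<lambda>_. 1"]
      by (auto intro: mono_on_transition_op)
  qed (simp add: mono_on_def)
  fix u v :: real assume uv: "u \<in> {0..}" "v \<in> {0..}" "u \<le> v"
  show "survival_prob u \<le> survival_prob v"
    by (rule LIMSEQ_le[OF funpow_transition_op_one_tendsto_survival_prob[OF uv(1)]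
          funpow_transition_op_one_tendsto_survival_prob[OF uv(2)]])
      (use mono_onD[OF mono uv] in blast)
qed

end

subsection \<open>Uniform exit from bounded intervals\<close>

locale exiting_risk_model = risk_model +
  assumes U_mono_time: "\<And>u. 0 \<le> u \<Longrightarrow> mono_on {0..} (U u)"
    and U_lim: "\<And>u. 0 \<le> u \<Longrightarrow> filterlim (U u) at_top at_top"
    and KF_less_1: "\<And>t z. 0 \<le> t \<Longrightarrow> 0 \<le> z \<Longrightarrow> K t * F z < 1"
begin

lemma U_mono_both: "0 \<le> u \<Longrightarrow> u \<le> v \<Longrightarrow> 0 \<le> s \<Longrightarrow> s \<le> t \<Longrightarrow> U u s \<le> U v t"
  using mono_onD[OF U_mono, of s u v] mono_onD[OF U_mono_time, of v s t] by simp

lemma exits_uniformly_of_rectangle: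
  assumes pos: "0 < measure (interval_measure K) R * measure (interval_measure F) Q"
    and meas: "R \<in> sets borel" "Q \<in> sets borel"
    and exit: "\<And>u p. 0 \<le> u \<Longrightarrow> u \<le> b \<Longrightarrow> p \<in> R \<times> Q \<Longrightarrow> reserve_after_claim u p \<notin> {0..b}"
  shows "exits_uniformly {0..b}"
  unfolding exits_uniformly_def
proof (intro exI conjI ballI)
  fix u assume u: "u \<in> {0..} \<inter> {0..b}"
  then have [measurable]: "reserve_after_claim u \<in> borel_measurable claim_law"
    by (intro measurable_X_right) simp
  have "{p \<in> space claim_law. reserve_after_claim u p \<notin> {0..b}} \<in> sets claim_law"
    by measurable
  then have "P.prob (R \<times> Q) \<le> P.prob {p \<in> space claim_law. reserve_after_claim u p \<notin> {0..b}}"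
    using exit u by (intro P.finite_measure_mono) (auto simp: space_pair_measure)
  then show "measure (interval_measure K) R * measure (interval_measure F) Q
      \<le> P.prob {p \<in> space claim_law. reserve_after_claim u p \<notin> {0..b}}"
    using meas by (simp add: prob_Times)
qed (rule pos)

lemma exits_uniformly_by_ruin:
  assumes "\<And>z. F z < 1"
  shows "exits_uniformly {0..b}"
proof -
  obtain t where t: "0 \<le> t" "0 < K t" using distribution_function_pos[OF K_dist] .
  show ?thesis
  proof (rule exits_uniformly_of_rectangle)
    show "0 < measure (interval_measure K) {..t} * measure (interval_measure F) {U b t<..}"
      using t assms by (simp add: measure_distribution_function_Iic[OF K_dist]
          measure_distribution_function_Ioi[OF F_dist])
    show "reserve_after_claim u p \<notin> {0..b}" if "0 \<le> u" "u \<le> b" "p \<in> {..t} \<times> {U b t<..}" for u p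
      using U_mono_both[of u b "max 0 (fst p)" t] that t by (auto simp: reserve_after_claim_def)
  qed simp_all
qed

lemma exits_uniformly_by_growth:
  assumes "\<And>t. 0 \<le> t \<Longrightarrow> K t < 1"
  shows "exits_uniformly {0..b}"
proof -
  obtain z where z: "0 \<le> z" "0 < F z" using distribution_function_pos[OF F_dist] .
  have "\<forall>\<^sub>F t in at_top. b + z < U 0 t"
    using U_lim[of 0] by (simp add: filterlim_at_top_dense)
  then obtain t where t: "0 \<le> t" "b + z < U 0 t"
    by (rule eventually_at_top_obtains_ge)
  show ?thesis
  proof (rule exits_uniformly_of_rectangle)
    show "0 < measure (interval_measure K) {t<..} * measure (interval_measure F) {..z}"
      using assms[OF t(1)] z by (simp add: measure_distribution_function_Ioi[OF K_dist]
          measure_distribution_function_Iic[OF F_dist])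
    show "reserve_after_claim u p \<notin> {0..b}" if "0 \<le> u" "u \<le> b" "p \<in> {t<..} \<times> {..z}" for u p
      using U_mono_both[of 0 u t "max 0 (fst p)"] that t by (auto simp: reserve_after_claim_def)
  qed simp_all
qed

lemma exits_uniformly_atLeastAtMost: "exits_uniformly {0..b}"
proof (cases "\<forall>z. F z < 1")
  case True
  then show ?thesis by (intro exits_uniformly_by_ruin) simp
next
  case False
  then obtain z where "F z = 1"
    using distribution_function_le_1[OF F_dist] by (metis order.antisym not_le)
  moreover from this have "0 \<le> z" using F_neg[of z] by force
  ultimately show ?thesis
    using KF_less_1[of _ z] by (intro exits_uniformly_by_growth) simp
qed

lemma small_off_exit_sets_of_tendsto:
  assumes "(\<delta> \<longlongrightarrow> 0) at_top"
  shows "small_off_exit_sets \<delta>"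
  unfolding small_off_exit_sets_def
proof (intro allI impI)
  fix \<epsilon> :: real assume "0 < \<epsilon>"
  then obtain b where "\<And>x. b \<le> x \<Longrightarrow> \<delta> x < \<epsilon>"
    using order_tendstoD(2)[OF assms] by (auto simp: eventually_at_top_linorder)
  then have "\<forall>x\<in>{0..} - {0..b}. \<delta> x \<le> \<epsilon>" by (auto intro: less_imp_le)
  then show "\<exists>D. exits_uniformly D \<and> (\<forall>x\<in>{0..} - D. \<delta> x \<le> \<epsilon>)"
    using exits_uniformly_atLeastAtMost by blast
qed

lemma small_off_exit_sets_one_minus:
  assumes "(\<phi> \<longlongrightarrow> 1) at_top"
  shows "small_off_exit_sets (\<lambda>x. 1 - \<phi> x)"
  using tendsto_diff[OF tendsto_const assms, of 1]
  by (intro small_off_exit_sets_of_tendsto) simp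

lemma risk_op_fixed_point_eq_survival_prob:
  assumes \<psi>: "\<psi> \<in> bounded_measurable 1" and fixed: "\<And>x. 0 \<le> x \<Longrightarrow> \<psi> x = risk_op F K U \<psi> x"
    and lim: "(\<psi> \<longlongrightarrow> 1) at_top" and u: "0 \<le> u"
  shows "\<psi> u = survival_prob u"
  using \<psi> _ small_off_exit_sets_one_minus[OF lim]
proof (rule transition_op_fixed_point_eq_survival_prob)
  show "transition_op \<psi> x = \<psi> x" if "x \<in> {0..}" for x
    using fixed[of x] that by (simp add: risk_op_eq_transition_op[OF \<psi>])
qed (simp add: u)

context
  fixes s :: "real \<Rightarrow> real"
  assumes s: "s \<in> bounded_measurable 1" and sub: "\<And>x. 0 \<le> x \<Longrightarrow> s x \<le> transition_op s x"
    and lim: "(s \<longlongrightarrow> 1) at_top"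
begin

lemma survival_prob_tendsto_1: "(survival_prob \<longlongrightarrow> 1) at_top"
proof (rule tendsto_sandwich[OF _ _ lim tendsto_const])
  show "\<forall>\<^sub>F u in at_top. s u \<le> survival_prob u"
    using eventually_ge_at_top[of 0]
    by eventually_elim (use s sub in \<open>auto intro: subsolution_le_survival_prob\<close>)
  show "\<forall>\<^sub>F u in at_top. survival_prob u \<le> 1"
    using eventually_ge_at_top[of 0]
    by eventually_elim (simp add: survival_prob_le_1)
qed

lemma funpow_risk_op_tendsto_survival_prob:
  assumes meas: "f \<in> borel_measurable (restrict_space borel {0..})"
    and le: "\<And>x. 0 \<le> x \<Longrightarrow> s x \<le> f x" "\<And>x. 0 \<le> x \<Longrightarrow> f x \<le> 1" and u: "0 \<le> u"
  shows "(\<lambda>k. (risk_op F K U ^^ k) f u) \<longlonglongrightarrow> survival_prob u"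
proof -
  have "\<bar>f x\<bar> \<le> 1" if "0 \<le> x" for x
    using le[OF that] bounded_measurable_abs_le[OF s, of x] that by auto
  then have f: "f \<in> bounded_measurable 1"
    using meas by (simp add: bounded_measurable_def)
  then show ?thesis
    using funpow_transition_op_tendsto_survival_prob[OF s sub small_off_exit_sets_one_minus[OF lim]]
      le u
    by (simp add: funpow_risk_op_eq_transition_op[OF f])
qed

end

end

subsection \<open>The exponential subsolution\<close>

text \<open>\<open>E exp (L (Z - c\<^sub>0 T)) \<le> 1\<close>, written for independent \<open>Z\<close> and \<open>T\<close>.\<close>

definition lundberg_condition :: "(real \<Rightarrow> real) \<Rightarrow> (real \<Rightarrow> real) \<Rightarrow> real \<Rightarrow> real \<Rightarrow> bool" where
  "lundberg_condition F K c\<^sub>0 L \<longleftrightarrow>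
     (\<integral>\<^sup>+z\<in>{0..}. ennreal (exp (L * z)) \<partial>interval_measure F) *
     (\<integral>\<^sup>+t\<in>{0..}. ennreal (exp (- c\<^sub>0 * L * t)) \<partial>interval_measure K) \<le> 1"

lemma phi_star_nonneg: "0 \<le> phi_star L u\<^sub>0 u"
  by (simp add: phi_star_def)

lemma phi_star_le_1: "phi_star L u\<^sub>0 u \<le> 1"
  by (simp add: phi_star_def)

lemma phi_star_tendsto_1:
  assumes "0 < L"
  shows "(phi_star L u\<^sub>0 \<longlongrightarrow> 1) at_top"
proof -
  have "filterlim (\<lambda>x. L * (- u\<^sub>0 + x)) at_top at_top"
    using assms by (intro filterlim_tendsto_pos_mult_at_top[OF tendsto_const]
        filterlim_tendsto_add_at_top[OF tendsto_const] filterlim_ident)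
  then have "((\<lambda>x. exp (- (L * (- u\<^sub>0 + x)))) \<longlongrightarrow> 0) at_top"
    by (intro filterlim_compose[OF exp_at_bot] filterlim_compose[OF filterlim_uminus_at_bot_at_top])
  then have "((\<lambda>x. max 0 (1 - exp (- (L * (- u\<^sub>0 + x))))) \<longlongrightarrow> max 0 (1 - 0)) at_top"
    by (intro tendsto_intros)
  then show ?thesis by (simp add: phi_star_def[abs_def])
qed

context risk_model
begin

lemma phi_star_bounded_measurable: "phi_star L u\<^sub>0 \<in> bounded_measurable 1"
proof (rule bounded_measurable_1I)
  have "phi_star L u\<^sub>0 \<in> borel_measurable borel"
    unfolding phi_star_def by measurable
  then show "phi_star L u\<^sub>0 \<in> borel_measurable (restrict_space borel {0..})"
    by (rule measurable_restrict_space1)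
qed (simp_all add: phi_star_nonneg phi_star_le_1)

lemma one_minus_killed_phi_star_le:
  assumes "0 < L" "0 \<le> u\<^sub>0"
  shows "1 - killed (phi_star L u\<^sub>0) x \<le> exp (- L * (x - u\<^sub>0))"
proof (cases "0 \<le> x")
  case True
  then show ?thesis by (simp add: killed_def phi_star_def)
next
  case False
  then show ?thesis using assms by (simp add: killed_def mult_le_0_iff)
qed

lemma nn_integral_exp_reserve_le:
  assumes "0 \<le> L"
    and growth: "\<And>t. 0 \<le> t \<Longrightarrow> u + c\<^sub>0 * t \<le> U u t"
    and lundberg: "lundberg_condition F K c\<^sub>0 L"
  shows "(\<integral>\<^sup>+p. ennreal (exp (- L * (reserve_after_claim u p - u\<^sub>0))) \<partial>claim_law)
    \<le> ennreal (exp (- L * (u - u\<^sub>0)))"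
proof -
  let ?e = "exp (- L * (u - u\<^sub>0))"
  let ?k = "\<lambda>t. ennreal (exp (- c\<^sub>0 * L * t)) * indicator {0..} t"
  let ?f = "\<lambda>z. ennreal (exp (L * z)) * indicator {0..} z"
  have bound: "exp (- L * (reserve_after_claim u p - u\<^sub>0))
      \<le> ?e * (exp (- c\<^sub>0 * L * fst p) * exp (L * snd p))" if "0 \<le> fst p" for p
  proof -
    have "L * (u + c\<^sub>0 * fst p) \<le> L * U u (fst p)"
      using growth[OF that] \<open>0 \<le> L\<close> by (rule mult_left_mono)
    then show ?thesis
      using that by (simp add: reserve_after_claim_def exp_add[symmetric] algebra_simps)
  qed
  have "(\<integral>\<^sup>+p. ennreal (exp (- L * (reserve_after_claim u p - u\<^sub>0))) \<partial>claim_law)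
      \<le> (\<integral>\<^sup>+p. ennreal ?e * (?k (fst p) * ?f (snd p)) \<partial>claim_law)"
    using AE_claim_law_nonneg
  proof (intro nn_integral_mono_AE, eventually_elim)
    case (elim p)
    then show ?case using ennreal_leI[OF bound] by (simp add: ennreal_mult)
  qed
  also have "\<dots> = ennreal ?e * (\<integral>\<^sup>+p. ?k (fst p) * ?f (snd p) \<partial>claim_law)"
    by (rule nn_integral_cmult) measurable
  also have "\<dots> = ennreal ?e *
      (integral\<^sup>N (interval_measure F) ?f * integral\<^sup>N (interval_measure K) ?k)"
    by (subst F.nn_integral_pair_mult) (measurable, simp add: mult.commute)
  also have "\<dots> \<le> ennreal ?e * 1"
    using lundberg by (intro mult_left_mono) (simp_all add: lundberg_condition_def)
  finally show ?thesis by simp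
qed

lemma phi_star_le_transition_op:
  assumes "0 < L" "0 \<le> u\<^sub>0"
    and growth: "\<And>u t. u\<^sub>0 \<le> u \<Longrightarrow> 0 \<le> t \<Longrightarrow> u + c\<^sub>0 * t \<le> U u t"
    and lundberg: "lundberg_condition F K c\<^sub>0 L"
    and u: "0 \<le> u"
  shows "phi_star L u\<^sub>0 u \<le> transition_op (phi_star L u\<^sub>0) u"
proof -
  let ?h = "\<lambda>p. killed (phi_star L u\<^sub>0) (reserve_after_claim u p)"
  have nonneg: "0 \<le> transition_op (phi_star L u\<^sub>0) u"
    by (intro transition_op_nonneg phi_star_nonneg)
  have int: "integrable claim_law ?h"
    using u by (intro integrable_killed_X[OF phi_star_bounded_measurable]) simp
  have "1 - exp (- L * (u - u\<^sub>0)) \<le> transition_op (phi_star L u\<^sub>0) u" if "u\<^sub>0 \<le> u"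
  proof -
    have "ennreal (1 - transition_op (phi_star L u\<^sub>0) u) = ennreal (\<integral>p. 1 - ?h p \<partial>claim_law)"
      using int by (simp add: transition_op_def P.prob_space)
    also have "\<dots> = (\<integral>\<^sup>+p. ennreal (1 - ?h p) \<partial>claim_law)"
      using int by (intro nn_integral_eq_integral[symmetric])
        (auto simp: killed_def phi_star_le_1)
    also have "\<dots> \<le> (\<integral>\<^sup>+p. ennreal (exp (- L * (reserve_after_claim u p - u\<^sub>0))) \<partial>claim_law)"
      by (intro nn_integral_mono ennreal_leI one_minus_killed_phi_star_le assms)
    also have "\<dots> \<le> ennreal (exp (- L * (u - u\<^sub>0)))"
      using growth[OF that] lundberg \<open>0 < L\<close> by (intro nn_integral_exp_reserve_le) auto
    finally show ?thesis by simp
  qed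
  moreover have "1 - exp (- L * (u - u\<^sub>0)) \<le> 0" if "u < u\<^sub>0"
    using \<open>0 < L\<close> that by (simp add: mult_le_0_iff)
  ultimately show ?thesis
    using nonneg by (cases "u\<^sub>0 \<le> u") (auto simp: phi_star_def)
qed

end

theorem theorem5p1:
  fixes F K c :: "real \<Rightarrow> real" and U :: "real \<Rightarrow> real \<Rightarrow> real" and u\<^sub>0 c\<^sub>0 L :: real
  assumes F: "distribution_function F" "\<forall>z\<le>0. F z = 0"
    and K: "distribution_function K" "\<forall>t<0. K t = 0"
    and c: "piecewise_continuous c" "\<forall>x\<ge>0. c x \<ge> 0"
    and U: "reserve_flow c U"
    and a: "\<forall>t\<ge>0. mono_on {0..} (\<lambda>u. U u t)"
           "\<forall>u\<ge>0. mono_on {0..} (\<lambda>t. U u t)"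
           "\<forall>u\<ge>0. filterlim (\<lambda>t. U u t) at_top at_top"
    and b: "u\<^sub>0 \<ge> 0" "c\<^sub>0 > 0" "L > 0"
           "\<forall>u\<ge>u\<^sub>0. \<forall>t\<ge>0. U u t \<ge> u + c\<^sub>0 * t"
           "(\<integral>\<^sup>+z\<in>{0..}. ennreal (exp (L * z)) \<partial>interval_measure F) *
            (\<integral>\<^sup>+t\<in>{0..}. ennreal (exp (- c\<^sub>0 * L * t)) \<partial>interval_measure K) \<le> 1"
    and cc: "\<forall>t\<ge>0. \<forall>z\<ge>0. K t * F z < 1"
  shows "\<exists>\<phi> :: real \<Rightarrow> real.
    \<comment> \<open>1)\<close>
    (mono_on {0..} \<phi> \<and> (\<forall>u\<ge>0. \<phi> u = risk_op F K U \<phi> u) \<and>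
     (\<forall>u\<ge>0. phi_star L u\<^sub>0 u \<le> \<phi> u \<and> \<phi> u \<le> 1)) \<and>
    \<comment> \<open>2)\<close>
    (\<phi> \<longlongrightarrow> 1) at_top \<and>
    (\<forall>\<psi> :: real \<Rightarrow> real.
       mono_on {0..} \<psi> \<and> (\<forall>u\<ge>0. 0 \<le> \<psi> u \<and> \<psi> u \<le> 1) \<and>
       (\<forall>u\<ge>0. \<psi> u = risk_op F K U \<psi> u) \<and> (\<psi> \<longlongrightarrow> 1) at_top
       \<longrightarrow> (\<forall>u\<ge>0. \<psi> u = \<phi> u)) \<and>
    \<comment> \<open>3)\<close>
    (\<forall>u\<ge>0. decseq (\<lambda>k. (risk_op F K U ^^ k) (\<lambda>_. 1) u) \<and>
            (\<lambda>k. (risk_op F K U ^^ k) (\<lambda>_. 1) u) \<longlonglongrightarrow> \<phi> u) \<and>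
    (\<forall>u\<ge>0. incseq (\<lambda>k. (risk_op F K U ^^ k) (phi_star L u\<^sub>0) u) \<and>
            (\<lambda>k. (risk_op F K U ^^ k) (phi_star L u\<^sub>0) u) \<longlonglongrightarrow> \<phi> u) \<and>
    \<comment> \<open>4)\<close>
    (\<forall>\<phi>\<^sub>0 :: real \<Rightarrow> real.
       \<phi>\<^sub>0 \<in> borel_measurable (restrict_space borel {0..}) \<and>
       (\<forall>u\<ge>0. phi_star L u\<^sub>0 u \<le> \<phi>\<^sub>0 u \<and> \<phi>\<^sub>0 u \<le> 1)
       \<longrightarrow> (\<forall>u\<ge>0. (\<lambda>k. (risk_op F K U ^^ k) \<phi>\<^sub>0 u) \<longlonglongrightarrow> \<phi> u))"
proof -
  interpret exiting_risk_model F K U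
    using F K U a cc by unfold_locales (auto simp: reserve_flow_def cauchy_solution_def)
  let ?s = "phi_star L u\<^sub>0"
  have sub: "?s u \<le> transition_op ?s u" if "0 \<le> u" for u
    using b that
    by (intro phi_star_le_transition_op[where c\<^sub>0 = c\<^sub>0]) (auto simp: lundberg_condition_def)
  note s = phi_star_bounded_measurable sub and s_lim = phi_star_tendsto_1[OF b(3)]
  note converges = funpow_risk_op_tendsto_survival_prob[OF s s_lim]
  show ?thesis
  proof (intro exI[of _ survival_prob] conjI allI impI; (elim conjE)?)
    show "mono_on {0..} survival_prob" by (rule mono_on_survival_prob)
    show "(survival_prob \<longlongrightarrow> 1) at_top" using s s_lim by (rule survival_prob_tendsto_1)
    fix u :: real assume u: "0 \<le> u"
    show "survival_prob u = risk_op F K U survival_prob u" using u by (rule survival_prob_eq_risk_op)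
    show "?s u \<le> survival_prob u" "survival_prob u \<le> 1"
      using s u by (auto intro: subsolution_le_survival_prob survival_prob_le_1)
    show "decseq (\<lambda>k. (risk_op F K U ^^ k) (\<lambda>_. 1) u)" using u by (rule decseq_funpow_risk_op_one)
    show "incseq (\<lambda>k. (risk_op F K U ^^ k) ?s u)" using s u by (rule incseq_funpow_risk_op)
    show "(\<lambda>k. (risk_op F K U ^^ k) (\<lambda>_. 1) u) \<longlonglongrightarrow> survival_prob u"
      "(\<lambda>k. (risk_op F K U ^^ k) ?s u) \<longlonglongrightarrow> survival_prob u"
      using u by (simp_all add: converges phi_star_le_1 measurable_of_bounded_measurable[OF s(1)])
    show "\<psi> u = survival_prob u" if "mono_on {0..} \<psi>" "\<forall>u\<ge>0. 0 \<le> \<psi> u \<and> \<psi> u \<le> 1"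
      "\<forall>u\<ge>0. \<psi> u = risk_op F K U \<psi> u" "(\<psi> \<longlongrightarrow> 1) at_top" for \<psi>
      using that u by (intro risk_op_fixed_point_eq_survival_prob bounded_measurable_1I
          borel_measurable_mono_on_fnc) auto
  qed (auto intro: converges)
qed

end
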